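(* Let $X$ and $Y$ be $n$-note scales equipped with modes $\mu_i : X \to \mathbb{Z}_n$ and $\mu_j : Y \to \mathbb{Z}_n$, and let $A$ and $B$ be subsets of $X$ and $Y$ respectively, each containing the tonic of its mode; identify $A$ and $B$ with their images $\mu_i(A), \mu_j(B) \subseteq \mathbb{Z}_n$ (so that $0\in A$ and $0\in B$). An orbit cover morphism $X^{(A)} \to Y^{(B)}$ exists if and only if there is an affine automorphism $f : \mathbb{Z}_n \to \mathbb{Z}_n$, $f(x) = ux+b$ for some $u\in\mathbb{Z}_n^\times$, $b\in\mathbb{Z}_n$, satisfying \[ f(A) \subseteq B, \] equivalently \[ u(A) \subseteq \mathrm{T}_{-b}(B). \] That is, $X^{(A)} \to Y^{(B)}$ admits an orbit cover morphism if and only if $\mathrm{Hom}_{\mathbf{C}(n)}(A,B) \neq \varnothing$.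
   Context: Pitch classes and modes. Fix $N$. An $n$-note scale is a set $X \subseteq \mathbb{Z}_N$ with $|X| = n$, equipped with the simply transitive $\mathbb{Z}_n$-action below. Its normal order $(x_0,\dots,x_{n-1})$ is the cyclic rotation of the ascending listing of $X$ with the smallest span, ties broken by the left-packing convention (smallest successive offsets from the first element). The map $\mu : X\to\mathbb{Z}_n$ is $\mu(x_k)=k$, and for $i\in\mathbb{Z}_n$ the $i$th mode is given by $\mu_i : X \to \mathbb{Z}_n$, $\mu_i(x) = \mu(x)+i$. The tonic of $\mu_i$ is the $t\in X$ with $\mu_i(t)=0$. Translations. For $m\in\mathbb{Z}_n$, $\mathrm{T}_m$ denotes translation by $m$ on $\mathbb{Z}_n$, and also scalar translation on $X$, $\mathrm{T}_m(x) = \mu_i^{-1}(m+\mu_i(x))$ (independent of $i$). Orbit covers. For $\varnothing\ne A\subseteq X$, the scalar orbit cover generated by $A$ is $X^{(A)} = \{\mathrm{T}_m(A) \mid m\in\mathbb{Z}_n\}$; its elements are called chords. Orbit cover morphisms. A group automorphism $h:\mathbb{Z}_n\to\mathbb{Z}_n$ induces the unique map $h_{i,j}:X\to Y$ with $\mu_j\circ h_{i,j} = h\circ\mu_i$. An orbit cover morphism $X^{(A)}\to Y^{(B)}$ is such a map $h_{i,j}$ (with $h$ a group automorphism of $\mathbb{Z}_n$) such that for every chord $A'\in X^{(A)}$ there exists a chord $B'\in Y^{(B)}$ with $h_{i,j}(A')\subseteq B'$. The category $\mathbf{C}(n)$. Its objects are the subsets of $\mathbb{Z}_n$ containing $0$.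 A morphism $A\to B$ is an affine automorphism $f:\mathbb{Z}_n\to\mathbb{Z}_n$, $f(x)=ux+b$ with $u\in\mathbb{Z}_n^\times$, $b\in\mathbb{Z}_n$, satisfying $f(A)\subseteq B$. Composition is composition of maps. Here $u(A) = \{ua \mid a\in A\}$. *)

theory Defs
  imports
    "HOL-Algebra.Elementary_Groups"
    "HOL-Library.FuncSet"
    "HOL-Library.List_Lexorder"
begin

text \<open>The cyclic group \<open>\<int>\<^sub>n\<close> is represented by the residues \<open>0, \<dots>, n - 1\<close>. For \<open>n = 0\<close> the library
  group is all of \<open>\<int>\<close>; nonempty scales exclude this case.\<close>

abbreviation Zmod :: "nat \<Rightarrow> int set" where
  "Zmod n \<equiv> carrier (integer_mod_group n)"

definition rotations :: "'a list \<Rightarrow> 'a list set" where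
  "rotations xs = {rotate k xs | k. True}"

definition span :: "nat \<Rightarrow> int list \<Rightarrow> int" where
  "span N xs = (last xs - hd xs) mod int N"

definition offsets :: "nat \<Rightarrow> int list \<Rightarrow> int list" where
  "offsets N xs = map (\<lambda>x. (x - hd xs) mod int N) xs"

text \<open>Lists of integers are ordered lexicographically. Since the span is put in front, a minimal key
  means: smallest span first, and ties are broken by smallest successive offsets.
  A scale with rotational symmetry (for instance \<open>{0, 4, 8}\<close> in \<open>\<int>\<^sub>1\<^sub>2\<close>) has several rotations with the
  same key; \<open>is_normal_order\<close> accepts each of them.\<close>

definition packing_key :: "nat \<Rightarrow> int list \<Rightarrow> int list" where
  "packing_key N xs = span N xs # offsets N xs"

definition is_normal_order :: "nat \<Rightarrow> int set \<Rightarrow> int list \<Rightarrow> bool" where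
  "is_normal_order N X xs \<longleftrightarrow>
     is_arg_min (packing_key N) (\<lambda>ys. ys \<in> rotations (sorted_list_of_set X)) xs"

text \<open>An \<open>n\<close>-note scale \<open>X\<close> in \<open>\<int>\<^sub>N\<close>, presented together with its normal order \<open>xs\<close>. All notions below
  take the scale in the form of its normal order, so that \<open>X = set xs\<close> and \<open>n = length xs\<close>.\<close>

definition note_scale :: "nat \<Rightarrow> nat \<Rightarrow> int set \<Rightarrow> int list \<Rightarrow> bool" where
  "note_scale N n X xs \<longleftrightarrow>
     0 < N \<and> 0 < n \<and> X \<subseteq> Zmod N \<and> card X = n \<and> is_normal_order N X xs"

definition scale_degree :: "int list \<Rightarrow> int \<Rightarrow> int" where
  "scale_degree xs x = int (THE k. k < length xs \<and> xs ! k = x)"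

definition mode :: "int list \<Rightarrow> int \<Rightarrow> int \<Rightarrow> int" where
  "mode xs i x = (scale_degree xs x + i) mod int (length xs)"

definition tonic :: "int list \<Rightarrow> int \<Rightarrow> int" where
  "tonic xs i = (THE t. t \<in> set xs \<and> mode xs i t = 0)"

definition translation :: "nat \<Rightarrow> int \<Rightarrow> int \<Rightarrow> int" where
  "translation n m x = (m + x) mod int n"

text \<open>Scalar translation is computed here in the mode \<open>0\<close>; lemma \<open>scalar_translation_eq\<close> below shows
  that every mode gives the same map.\<close>

definition scalar_translation :: "int list \<Rightarrow> int \<Rightarrow> int \<Rightarrow> int" where
  "scalar_translation xs m x =
     inv_into (set xs) (mode xs 0) (translation (length xs) m (mode xs 0 x))"

definition orbit_cover :: "int list \<Rightarrow> int set \<Rightarrow> int set set" where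
  "orbit_cover xs A = {scalar_translation xs m ` A | m. m \<in> Zmod (length xs)}"

text \<open>\<open>induced_by xs i ys j h \<phi>\<close> says that \<open>\<phi>\<close> is the map \<open>h\<^sub>i\<^sub>,\<^sub>j\<close> from \<open>set xs\<close> to \<open>set ys\<close>.\<close>

definition induced_by ::
  "int list \<Rightarrow> int \<Rightarrow> int list \<Rightarrow> int \<Rightarrow> (int \<Rightarrow> int) \<Rightarrow> (int \<Rightarrow> int) \<Rightarrow> bool" where
  "induced_by xs i ys j h \<phi> \<longleftrightarrow>
     \<phi> \<in> set xs \<rightarrow>\<^sub>E set ys \<and> (\<forall>x \<in> set xs. mode ys j (\<phi> x) = h (mode xs i x))"

definition mode_morphisms ::
  "int list \<Rightarrow> int \<Rightarrow> int list \<Rightarrow> int \<Rightarrow> int set set \<Rightarrow> int set set \<Rightarrow> (int \<Rightarrow> int) set" where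
  "mode_morphisms xs i ys j \<A> \<B> =
     {\<phi>. (\<exists>h \<in> iso (integer_mod_group (length xs)) (integer_mod_group (length ys)).
            induced_by xs i ys j h \<phi>) \<and>
         (\<forall>A' \<in> \<A>. \<exists>B' \<in> \<B>. \<phi> ` A' \<subseteq> B')}"

text \<open>In \<open>mode_morphisms\<close> the modes \<open>i\<close> and \<open>j\<close> are fixed. An orbit cover carries no distinguished
  mode, so in \<open>orbit_cover_morphisms\<close> they range over all modes.\<close>

definition orbit_cover_morphisms ::
  "int list \<Rightarrow> int list \<Rightarrow> int set set \<Rightarrow> int set set \<Rightarrow> (int \<Rightarrow> int) set" where
  "orbit_cover_morphisms xs ys \<A> \<B> =
     (\<Union>i \<in> Zmod (length xs). \<Union>j \<in> Zmod (length ys). mode_morphisms xs i ys j \<A> \<B>)"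

text \<open>The ring \<open>\<int>\<^sub>1\<close> is trivial and its only element \<open>0\<close> is a unit.\<close>

definition Zunits :: "nat \<Rightarrow> int set" where
  "Zunits n = {u \<in> Zmod n. \<exists>v \<in> Zmod n. (u * v) mod int n = 1 mod int n}"

definition affine_map :: "nat \<Rightarrow> int \<Rightarrow> int \<Rightarrow> int \<Rightarrow> int" where
  "affine_map n u b = (\<lambda>x \<in> Zmod n. (u * x + b) mod int n)"

definition dilation :: "nat \<Rightarrow> int \<Rightarrow> int \<Rightarrow> int" where
  "dilation n u x = (u * x) mod int n"

definition C_obj :: "nat \<Rightarrow> int set set" where
  "C_obj n = {A. A \<subseteq> Zmod n \<and> 0 \<in> A}"

definition C_hom :: "nat \<Rightarrow> int set \<Rightarrow> int set \<Rightarrow> (int \<Rightarrow> int) set" where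
  "C_hom n A B = {f. (\<exists>u \<in> Zunits n. \<exists>b \<in> Zmod n. f = affine_map n u b) \<and> f ` A \<subseteq> B}"

lemma normal_order_exists:
  "\<exists>xs. is_normal_order N X xs"
proof -
  let ?ys = "sorted_list_of_set X"
  have "rotations ?ys \<subseteq> {zs. set zs \<subseteq> set ?ys \<and> length zs \<le> length ?ys}"
    by (auto simp: rotations_def)
  then have fin: "finite (rotations ?ys)"
    using finite_lists_length_le[of "set ?ys"] by (metis (no_types) List.finite_set finite_subset)
  have "?ys \<in> rotations ?ys"
    unfolding rotations_def by (auto intro: exI[of _ 0])
  then have "\<exists>xs. is_arg_min (packing_key N) (\<lambda>zs. zs \<in> rotations ?ys) xs"
    using ex_is_arg_min_if_finite[OF fin, of "packing_key N"] by auto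
  then show ?thesis
    by (simp add: is_normal_order_def)
qed

lemma normal_order_list:
  assumes "note_scale N n X xs"
  shows "set xs = X" "distinct xs" "length xs = n" "0 < n"
proof -
  have "finite X"
    using assms by (auto simp: note_scale_def intro: card_ge_0_finite)
  then show "set xs = X" "distinct xs" "length xs = n" "0 < n"
    using assms
    by (auto simp: note_scale_def is_normal_order_def is_arg_min_def rotations_def)
qed

lemma mode_nth:
  assumes "distinct xs" "k < length xs"
  shows "mode xs i (xs ! k) = (int k + i) mod int (length xs)"
proof -
  have "(THE l. l < length xs \<and> xs ! l = xs ! k) = k"
    using assms by (intro the_equality) (auto simp: nth_eq_iff_index_eq)
  then show ?thesis
    by (simp add: mode_def scale_degree_def)
qed

lemma bij_betw_mode:
  assumes "distinct xs" "xs \<noteq> []"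
  shows "bij_betw (mode xs i) (set xs) (Zmod (length xs))"
proof -
  have inj: "inj_on (mode xs i) (set xs)"
  proof (rule inj_onI)
    fix x y assume "x \<in> set xs" "y \<in> set xs" and eq: "mode xs i x = mode xs i y"
    then obtain k l where k: "k < length xs" "x = xs ! k" and l: "l < length xs" "y = xs ! l"
      by (metis in_set_conv_nth)
    have "(int k + i) mod int (length xs) = (int l + i) mod int (length xs)"
      using eq k l assms(1) by (simp add: mode_nth)
    then have "int k mod int (length xs) = int l mod int (length xs)"
      by (metis add_diff_cancel_right' mod_diff_left_eq)
    then show "x = y" using k l by simp
  qed
  have sub: "mode xs i ` set xs \<subseteq> Zmod (length xs)"
    using assms(2) by (auto simp: mode_def carrier_integer_mod_group)
  have "card (mode xs i ` set xs) = card (Zmod (length xs))"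
    using inj assms by (simp add: card_image distinct_card carrier_integer_mod_group)
  then have "mode xs i ` set xs = Zmod (length xs)"
    using sub assms(2) by (intro card_subset_eq) (auto simp: carrier_integer_mod_group)
  with inj show ?thesis by (simp add: bij_betw_def)
qed

lemma mode_scalar_translation:
  assumes "distinct xs" "x \<in> set xs"
  shows "scalar_translation xs m x \<in> set xs"
    and "mode xs i (scalar_translation xs m x) = translation (length xs) m (mode xs i x)"
proof -
  have ne: "xs \<noteq> []" using assms by auto
  have "translation (length xs) m (mode xs 0 x) \<in> Zmod (length xs)"
    using ne by (simp add: translation_def carrier_integer_mod_group)
  then have t: "translation (length xs) m (mode xs 0 x) \<in> mode xs 0 ` set xs"
    using bij_betw_mode[OF assms(1) ne] by (simp add: bij_betw_def)
  show "scalar_translation xs m x \<in> set xs"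
    unfolding scalar_translation_def by (rule inv_into_into[OF t])
  have shift: "mode xs i y = (mode xs 0 y + i) mod int (length xs)" for y
    by (simp add: mode_def mod_add_left_eq)
  have "mode xs 0 (scalar_translation xs m x) = translation (length xs) m (mode xs 0 x)"
    unfolding scalar_translation_def by (rule f_inv_into_f[OF t])
  then show "mode xs i (scalar_translation xs m x) = translation (length xs) m (mode xs i x)"
    by (simp add: shift[of "scalar_translation xs m x"] shift[of x] translation_def
        mod_add_left_eq mod_add_right_eq add.assoc)
qed

lemma scalar_translation_eq:
  assumes "distinct xs" "x \<in> set xs"
  shows "scalar_translation xs m x =
    inv_into (set xs) (mode xs i) (translation (length xs) m (mode xs i x))"
proof -
  have "xs \<noteq> []" using assms(2) by auto
  then have "inj_on (mode xs i) (set xs)"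
    using bij_betw_mode[OF assms(1)] by (simp add: bij_betw_def)
  from inv_into_f_f[OF this mode_scalar_translation(1)[OF assms, of m]]
  show ?thesis
    by (simp add: mode_scalar_translation(2)[OF assms])
qed

end

theory Submission
  imports Defs
begin

text \<open>A mode is a coordinate on a scale: it identifies the scale with \<open>\<int>\<^sub>n\<close> and turns scalar
  translations into translations of \<open>\<int>\<^sub>n\<close> (\<open>image_mode_scalar_translation\<close>). Two facts about these
  coordinates carry the proof. First, the automorphisms of \<open>\<int>\<^sub>n\<close> are exactly the multiplications by
  units (\<open>iso_integer_mod_group_imp_dilation\<close>, \<open>dilation_iso\<close>). Second, another choice of mode moves a
  coordinate by a constant. Hence an orbit cover morphism, in whatever modes it is presented, reads in
  the coordinates \<open>i\<close> and \<open>j\<close> as an affine map \<open>x \<mapsto> u x + c\<close> with a unit \<open>u\<close>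
  (\<open>induced_by_dilation_affine\<close>).

  Such a map sends \<open>T\<^sub>m(A)\<close> into \<open>T\<^sub>k(B)\<close> exactly if \<open>x \<mapsto> u x + (u m + c - k)\<close> sends \<open>A\<close> into \<open>B\<close>.
  Here \<open>k\<close> can be chosen freely for each chord \<open>T\<^sub>m(A)\<close>, so the constant term can be given any value:
  the constant \<open>c\<close>, and with it the choice of modes, drops out, and mapping every chord
  into some chord amounts to having one \<open>b\<close> such that \<open>x \<mapsto> u x + b\<close> sends \<open>A\<close> into \<open>B\<close>
  (\<open>affine_respects_orbit_covers_iff\<close>).\<close>

section \<open>Automorphisms of the cyclic group\<close>

text \<open>The group is generated by \<open>1\<close>, so a homomorphism is determined by \<open>u = h 1\<close>. The residue of \<open>1\<close>
  is written \<open>1 mod n\<close> because it is \<open>0\<close> when \<open>n = 1\<close>.\<close>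

lemma hom_integer_mod_group_eq_dilation:
  assumes n: "0 < n" and h: "h \<in> hom (integer_mod_group n) (integer_mod_group n)"
    and x: "x \<in> Zmod n"
  shows "h x = dilation n (h (1 mod int n)) x"
proof -
  let ?u = "h (1 mod int n)"
  have one: "1 mod int n \<in> Zmod n"
    using n by (simp add: carrier_integer_mod_group)
  have add: "h ((a + b) mod int n) = (h a + h b) mod int n" if "a \<in> Zmod n" "b \<in> Zmod n" for a b
    using hom_mult[OF h that] n by simp
  have "h (int k mod int n) = (?u * int k) mod int n" for k
  proof (induction k)
    case 0
    have "h 0 = 0"
      using hom_one[OF h] by (simp add: group_integer_mod_group)
    then show ?case by simp
  next
    case (Suc k)
    have "int (Suc k) mod int n = (int k mod int n + 1 mod int n) mod int n"
      by (simp add: mod_simps add.commute)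
    then have "h (int (Suc k) mod int n) = (h (int k mod int n) + ?u) mod int n"
      using add[of "int k mod int n" "1 mod int n"] one n
      by (simp add: carrier_integer_mod_group)
    also have "\<dots> = (?u * int (Suc k)) mod int n"
      by (simp add: Suc.IH mod_simps algebra_simps)
    finally show ?case .
  qed
  from this[of "nat x"] show ?thesis
    using x n by (simp add: carrier_integer_mod_group dilation_def)
qed

text \<open>An automorphism attains \<open>1\<close>, and a preimage of \<open>1\<close> is an inverse of the multiplier.\<close>

lemma iso_integer_mod_group_imp_dilation:
  assumes n: "0 < n" and h: "h \<in> iso (integer_mod_group n) (integer_mod_group n)"
  obtains u where "u \<in> Zunits n" "\<And>x. x \<in> Zmod n \<Longrightarrow> h x = dilation n u x"
proof
  let ?u = "h (1 mod int n)"
  have hom: "h \<in> hom (integer_mod_group n) (integer_mod_group n)"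
    and bij: "bij_betw h (Zmod n) (Zmod n)"
    using h by (auto simp: iso_def)
  show eq: "h x = dilation n ?u x" if "x \<in> Zmod n" for x
    using hom_integer_mod_group_eq_dilation[OF n hom that] .
  have one: "1 mod int n \<in> Zmod n"
    using n by (simp add: carrier_integer_mod_group)
  then obtain v where v: "v \<in> Zmod n" "h v = 1 mod int n"
    using bij by (metis bij_betw_imp_surj_on imageE)
  then have "(?u * v) mod int n = 1 mod int n"
    using eq[OF v(1)] by (simp add: dilation_def)
  moreover have "?u \<in> Zmod n"
    using bij one bij_betwE by blast
  ultimately show "?u \<in> Zunits n"
    using v(1) by (auto simp: Zunits_def)
qed

lemma dilation_iso:
  assumes n: "0 < n" and u: "u \<in> Zunits n"
  shows "dilation n u \<in> iso (integer_mod_group n) (integer_mod_group n)"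
proof -
  obtain v where uv: "(u * v) mod int n = 1 mod int n"
    using u by (auto simp: Zunits_def)
  have closed: "dilation n w x \<in> Zmod n" for w x
    using n by (simp add: dilation_def carrier_integer_mod_group)
  have cancel: "(u * (v * x)) mod int n = x" if "x \<in> Zmod n" for x
  proof -
    have "(u * v * x) mod int n = (1 * x) mod int n"
      using uv by (metis mod_mult_left_eq)
    then show ?thesis
      using that n by (simp add: carrier_integer_mod_group mult.assoc)
  qed
  have "bij_betw (dilation n u) (Zmod n) (Zmod n)"
  proof (rule bij_betw_byWitness[where f' = "dilation n v"])
    show "\<forall>x \<in> Zmod n. dilation n v (dilation n u x) = x"
      using cancel by (simp add: dilation_def mod_simps mult.left_commute)
    show "\<forall>x \<in> Zmod n. dilation n u (dilation n v x) = x"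
      using cancel by (simp add: dilation_def mod_simps)
  qed (use closed in auto)
  moreover have "dilation n u \<in> hom (integer_mod_group n) (integer_mod_group n)"
    using n closed by (auto intro!: homI simp: dilation_def mod_simps distrib_left)
  ultimately show ?thesis
    by (simp add: iso_def)
qed

section \<open>Scales in coordinates\<close>

lemma mode_in_Zmod: "xs \<noteq> [] \<Longrightarrow> mode xs i x \<in> Zmod (length xs)"
  by (simp add: mode_def carrier_integer_mod_group)

lemma mode_change: "mode xs i x = (mode xs i' x + (i - i')) mod int (length xs)"
  by (simp add: mode_def mod_simps)

lemma mode_tonic:
  assumes "distinct xs" "xs \<noteq> []"
  shows "tonic xs i \<in> set xs" "mode xs i (tonic xs i) = 0"
proof -
  have bij: "bij_betw (mode xs i) (set xs) (Zmod (length xs))"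
    using bij_betw_mode[OF assms] .
  have "0 \<in> Zmod (length xs)"
    using assms(2) by (simp add: carrier_integer_mod_group)
  then obtain t where t: "t \<in> set xs" "mode xs i t = 0"
    using bij by (metis bij_betw_imp_surj_on imageE)
  have "s = t" if "s \<in> set xs" "mode xs i s = 0" for s
    using inj_onD[OF bij_betw_imp_inj_on[OF bij]] that t by simp
  with t have "\<exists>!t. t \<in> set xs \<and> mode xs i t = 0"
    by blast
  from theI'[OF this] show "tonic xs i \<in> set xs" "mode xs i (tonic xs i) = 0"
    unfolding tonic_def by (rule conjunct1, rule conjunct2)
qed

lemma image_mode_scalar_translation:
  assumes "distinct xs" "A \<subseteq> set xs"
  shows "mode xs i ` (scalar_translation xs m ` A) = translation (length xs) m ` (mode xs i ` A)"
  unfolding image_image using assms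
  by (intro image_cong refl mode_scalar_translation(2)) auto

text \<open>A mode is injective, so inclusions of subsets of a scale can be tested on coordinates.\<close>

lemma image_mode_subset_iff:
  assumes "distinct xs" "C \<subseteq> set xs" "D \<subseteq> set xs"
  shows "mode xs i ` C \<subseteq> mode xs i ` D \<longleftrightarrow> C \<subseteq> D"
proof (cases "xs = []")
  case False
  then have "inj_on (mode xs i) (set xs)"
    using bij_betw_mode[OF assms(1)] by (simp add: bij_betw_def)
  then show ?thesis
    using assms(2,3) by (fastforce dest: inj_onD)
qed (use assms in auto)

lemma mem_translation_image_iff:
  assumes "B \<subseteq> Zmod n" "0 < n"
  shows "x mod int n \<in> translation n k ` B \<longleftrightarrow> (x - k) mod int n \<in> B"
proof
  assume "x mod int n \<in> translation n k ` B"
  then obtain b where b: "b \<in> B" "x mod int n = (k + b) mod int n"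
    by (auto simp: translation_def)
  then have "(x - k) mod int n = b mod int n"
    by (metis add_diff_cancel_left' mod_diff_left_eq)
  also have "\<dots> = b"
    using b(1) assms by (auto simp: carrier_integer_mod_group)
  finally show "(x - k) mod int n \<in> B" using b(1) by simp
next
  assume B: "(x - k) mod int n \<in> B"
  have "x mod int n = translation n k ((x - k) mod int n)"
    by (simp add: translation_def mod_simps)
  with B show "x mod int n \<in> translation n k ` B" by (rule rev_image_eqI)
qed

lemma affine_map_image_subset_iff:
  assumes "A \<subseteq> Zmod n"
  shows "affine_map n u b ` A \<subseteq> B \<longleftrightarrow> (\<forall>a \<in> A. (u * a + b) mod int n \<in> B)"
  using assms by (auto simp: affine_map_def)

text \<open>Subtracting \<open>b\<close> on both sides: \<open>u a + b\<close> lies in \<open>B\<close> exactly if \<open>u a\<close> lies in the translate of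
  \<open>B\<close> by \<open>-b\<close>.\<close>

lemma affine_map_image_subset_iff_dilation:
  assumes "A \<subseteq> Zmod n" "B \<subseteq> Zmod n" "0 < n"
  shows "affine_map n u b ` A \<subseteq> B \<longleftrightarrow> dilation n u ` A \<subseteq> translation n (- b) ` B"
proof -
  have "dilation n u ` A \<subseteq> translation n (- b) ` B \<longleftrightarrow> (\<forall>a \<in> A. (u * a + b) mod int n \<in> B)"
    by (simp add: dilation_def image_subset_iff mem_translation_image_iff[OF assms(2,3)])
  then show ?thesis
    by (simp only: affine_map_image_subset_iff[OF assms(1)])
qed

section \<open>Orbit cover morphisms\<close>

text \<open>Passing from the modes \<open>i'\<close>, \<open>j'\<close> to \<open>i\<close>, \<open>j\<close> turns a linear map into an affine one with the same
  multiplier, since the two shifts can be collected into the constant term.\<close>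

lemma induced_by_dilation_affine:
  assumes \<phi>: "induced_by xs i' ys j' h \<phi>" and len: "length xs = n" "length ys = n"
    and h: "\<And>x. x \<in> Zmod n \<Longrightarrow> h x = dilation n u x" and x: "x \<in> set xs"
  shows "mode ys j (\<phi> x) = (u * mode xs i x + (u * (i' - i) + (j - j'))) mod int n"
proof -
  have "xs \<noteq> []"
    using x by auto
  then have "mode xs i' x \<in> Zmod n"
    using mode_in_Zmod len by blast
  then have "mode ys j' (\<phi> x) = (u * mode xs i' x) mod int n"
    using \<phi> x h by (simp add: induced_by_def dilation_def)
  also have "\<dots> = (u * (mode xs i x + (i' - i))) mod int n"
    using mode_change[of xs i' x i] len by (simp add: mod_simps)
  finally have "mode ys j (\<phi> x) = (u * (mode xs i x + (i' - i)) + (j - j')) mod int n"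
    using mode_change[of ys j "\<phi> x" j'] len by (simp only: mod_add_left_eq)
  then show ?thesis
    by (simp only: distrib_left add.assoc)
qed

text \<open>In coordinates, \<open>\<phi>\<close> maps \<open>T\<^sub>m(A)\<close> into \<open>T\<^sub>k(B)\<close> exactly if \<open>x \<mapsto> u x + (u m + c - k)\<close> maps \<open>A\<close> into
  \<open>B\<close>. For fixed \<open>m\<close> the constant term takes every value as \<open>k\<close> varies, so a single \<open>b\<close> serves all chords:
  the chord \<open>A\<close> itself yields \<open>b = c - k\<close>, and \<open>b\<close> in turn yields \<open>k = u m + c - b\<close> for each \<open>m\<close>.\<close>

lemma affine_respects_orbit_covers_iff:
  assumes dist: "distinct xs" "distinct ys" and len: "length xs = n" "length ys = n" and n: "0 < n"
    and A: "A \<subseteq> set xs" and B: "B \<subseteq> set ys"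
    and \<phi>: "\<And>x. x \<in> set xs \<Longrightarrow> \<phi> x \<in> set ys"
      "\<And>x. x \<in> set xs \<Longrightarrow> mode ys j (\<phi> x) = (u * mode xs i x + c) mod int n"
  shows "(\<forall>A' \<in> orbit_cover xs A. \<exists>B' \<in> orbit_cover ys B. \<phi> ` A' \<subseteq> B') \<longleftrightarrow>
    (\<exists>b \<in> Zmod n. affine_map n u b ` (mode xs i ` A) \<subseteq> mode ys j ` B)"
proof -
  let ?A = "mode xs i ` A" and ?B = "mode ys j ` B"
  have A0: "?A \<subseteq> Zmod n" and B0: "?B \<subseteq> Zmod n"
    using mode_in_Zmod[of xs] mode_in_Zmod[of ys] len n by force+
  have chord: "\<phi> ` (scalar_translation xs m ` A) \<subseteq> scalar_translation ys k ` B \<longleftrightarrow>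
      (\<forall>a \<in> ?A. (u * a + (u * m + c - k)) mod int n \<in> ?B)" for m k
  proof -
    have TA: "scalar_translation xs m ` A \<subseteq> set xs"
      using mode_scalar_translation(1)[OF dist(1)] A by auto
    have TB: "scalar_translation ys k ` B \<subseteq> set ys"
      using mode_scalar_translation(1)[OF dist(2)] B by auto
    have "mode ys j ` (\<phi> ` (scalar_translation xs m ` A)) =
        (\<lambda>a. (u * a + c) mod int n) ` (mode xs i ` (scalar_translation xs m ` A))"
      unfolding image_image using TA \<phi>(2) by (intro image_cong) auto
    also have "\<dots> = (\<lambda>a. (u * ((m + a) mod int n) + c) mod int n) ` ?A"
      by (simp only: image_mode_scalar_translation[OF dist(1) A])
        (simp add: image_image translation_def len)
    also have "\<dots> = (\<lambda>a. (u * (m + a) + c) mod int n) ` ?A"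
      by (intro image_cong refl) (metis mod_add_left_eq mod_mult_right_eq)
    finally have L: "mode ys j ` (\<phi> ` (scalar_translation xs m ` A)) =
        (\<lambda>a. (u * (m + a) + c) mod int n) ` ?A" .
    have "\<phi> ` (scalar_translation xs m ` A) \<subseteq> scalar_translation ys k ` B \<longleftrightarrow>
        (\<lambda>a. (u * (m + a) + c) mod int n) ` ?A \<subseteq> translation n k ` ?B"
      using image_mode_subset_iff[OF dist(2) _ TB, of "\<phi> ` (scalar_translation xs m ` A)" j] TA \<phi>(1)
      unfolding L image_mode_scalar_translation[OF dist(2) B] len by blast
    also have "\<dots> \<longleftrightarrow> (\<forall>a \<in> ?A. (u * (m + a) + c - k) mod int n \<in> ?B)"
      by (simp only: image_subset_iff mem_translation_image_iff[OF B0 n])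
    also have "\<dots> \<longleftrightarrow> (\<forall>a \<in> ?A. (u * a + (u * m + c - k)) mod int n \<in> ?B)"
      by (simp only: distrib_left add.assoc add.left_commute add_diff_eq)
    finally show ?thesis .
  qed
  have residue: "z mod int n \<in> Zmod n" for z
    using n by (simp add: carrier_integer_mod_group)
  show ?thesis
  proof
    assume covers: "\<forall>A' \<in> orbit_cover xs A. \<exists>B' \<in> orbit_cover ys B. \<phi> ` A' \<subseteq> B'"
    have "scalar_translation xs 0 ` A \<in> orbit_cover xs A"
      using residue[of 0] len by (auto simp: orbit_cover_def)
    with covers obtain k where
      "\<phi> ` (scalar_translation xs 0 ` A) \<subseteq> scalar_translation ys k ` B"
      by (auto simp: orbit_cover_def)
    then have "affine_map n u ((c - k) mod int n) ` ?A \<subseteq> ?B"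
      unfolding chord affine_map_image_subset_iff[OF A0] by (simp add: mod_simps)
    with residue show "\<exists>b \<in> Zmod n. affine_map n u b ` ?A \<subseteq> ?B" by blast
  next
    assume "\<exists>b \<in> Zmod n. affine_map n u b ` ?A \<subseteq> ?B"
    then obtain b where b: "\<forall>a \<in> ?A. (u * a + b) mod int n \<in> ?B"
      unfolding affine_map_image_subset_iff[OF A0] by blast
    show "\<forall>A' \<in> orbit_cover xs A. \<exists>B' \<in> orbit_cover ys B. \<phi> ` A' \<subseteq> B'"
    proof
      fix A' assume "A' \<in> orbit_cover xs A"
      then obtain m where A': "A' = scalar_translation xs m ` A"
        by (auto simp: orbit_cover_def)
      let ?k = "(u * m + c - b) mod int n"
      have "(u * a + (u * m + c - ?k)) mod int n = (u * a + b) mod int n" for a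
        by (simp add: add_diff_eq mod_simps)
      then have "\<phi> ` A' \<subseteq> scalar_translation ys ?k ` B"
        unfolding A' chord using b by simp
      moreover have "scalar_translation ys ?k ` B \<in> orbit_cover ys B"
        using residue len by (auto simp: orbit_cover_def)
      ultimately show "\<exists>B' \<in> orbit_cover ys B. \<phi> ` A' \<subseteq> B'" by blast
    qed
  qed
qed

lemma induced_by_exists:
  assumes "distinct ys" "length xs = n" "length ys = n" "0 < n"
    and h: "h ` Zmod n \<subseteq> Zmod n"
  obtains \<phi> where "induced_by xs i ys j h \<phi>"
proof
  let ?\<phi> = "\<lambda>x \<in> set xs. inv_into (set ys) (mode ys j) (h (mode xs i x))"
  have "xs \<noteq> []" "ys \<noteq> []"
    using assms(2-4) by auto
  then have "h (mode xs i x) \<in> mode ys j ` set ys" for x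
    using mode_in_Zmod[of xs i x] bij_betw_mode[OF assms(1), of j] h assms(2,3)
    by (auto simp: bij_betw_def)
  then show "induced_by xs i ys j h ?\<phi>"
    by (auto simp: induced_by_def inv_into_into f_inv_into_f)
qed

text \<open>The modes \<open>i'\<close>, \<open>j'\<close> that present the morphism are independent of the modes \<open>i\<close>, \<open>j\<close> that give the
  coordinates of \<open>A\<close> and \<open>B\<close>. The case of different modes is what makes the existence of a
  morphism a property of the orbit covers alone.\<close>

lemma mode_morphisms_nonempty_iff:
  assumes dist: "distinct xs" "distinct ys" and len: "length xs = n" "length ys = n" and n: "0 < n"
    and A: "A \<subseteq> set xs" and B: "B \<subseteq> set ys"
  shows "mode_morphisms xs i' ys j' (orbit_cover xs A) (orbit_cover ys B) \<noteq> {} \<longleftrightarrow>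
    (\<exists>u \<in> Zunits n. \<exists>b \<in> Zmod n. affine_map n u b ` (mode xs i ` A) \<subseteq> mode ys j ` B)"
proof -
  have key: "(\<forall>A' \<in> orbit_cover xs A. \<exists>B' \<in> orbit_cover ys B. \<phi> ` A' \<subseteq> B') \<longleftrightarrow>
      (\<exists>b \<in> Zmod n. affine_map n u b ` (mode xs i ` A) \<subseteq> mode ys j ` B)"
    if ind: "induced_by xs i' ys j' h \<phi>"
      and h: "\<And>x. x \<in> Zmod n \<Longrightarrow> h x = dilation n u x" for \<phi> h u
  proof (rule affine_respects_orbit_covers_iff[OF dist len n A B])
    show "\<phi> x \<in> set ys" if "x \<in> set xs" for x
      using ind that by (auto simp: induced_by_def)
  qed (rule induced_by_dilation_affine[OF ind len h])
  show ?thesis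
  proof
    assume "mode_morphisms xs i' ys j' (orbit_cover xs A) (orbit_cover ys B) \<noteq> {}"
    then obtain \<phi> h where h: "h \<in> iso (integer_mod_group n) (integer_mod_group n)"
      and ind: "induced_by xs i' ys j' h \<phi>"
      and covers: "\<forall>A' \<in> orbit_cover xs A. \<exists>B' \<in> orbit_cover ys B. \<phi> ` A' \<subseteq> B'"
      by (auto simp: mode_morphisms_def len)
    obtain u where u: "u \<in> Zunits n" "\<And>x. x \<in> Zmod n \<Longrightarrow> h x = dilation n u x"
      using iso_integer_mod_group_imp_dilation[OF n h] by blast
    show "\<exists>u \<in> Zunits n. \<exists>b \<in> Zmod n. affine_map n u b ` (mode xs i ` A) \<subseteq> mode ys j ` B"
      using key[OF ind u(2)] covers u(1) by blast
  next
    assume "\<exists>u \<in> Zunits n. \<exists>b \<in> Zmod n. affine_map n u b ` (mode xs i ` A) \<subseteq> mode ys j ` B"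
    then obtain u where u: "u \<in> Zunits n"
      and b: "\<exists>b \<in> Zmod n. affine_map n u b ` (mode xs i ` A) \<subseteq> mode ys j ` B"
      by blast
    have iso: "dilation n u \<in> iso (integer_mod_group n) (integer_mod_group n)"
      using dilation_iso[OF n u] .
    then have "dilation n u ` Zmod n \<subseteq> Zmod n"
      by (auto simp: iso_def bij_betw_def)
    then obtain \<phi> where ind: "induced_by xs i' ys j' (dilation n u) \<phi>"
      using induced_by_exists[OF dist(2) len n] by blast
    have "\<forall>A' \<in> orbit_cover xs A. \<exists>B' \<in> orbit_cover ys B. \<phi> ` A' \<subseteq> B'"
      using key[OF ind] b by simp
    with iso ind have "\<phi> \<in> mode_morphisms xs i' ys j' (orbit_cover xs A) (orbit_cover ys B)"
      unfolding mode_morphisms_def len by blast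
    then show "mode_morphisms xs i' ys j' (orbit_cover xs A) (orbit_cover ys B) \<noteq> {}" by blast
  qed
qed

theorem theorem5p1:
  fixes N n :: nat and X Y A B :: "int set" and xs ys :: "int list" and i j :: int
  assumes "note_scale N n X xs" and "note_scale N n Y ys"
    and "i \<in> Zmod n" and "j \<in> Zmod n"
    and "A \<subseteq> X" and "tonic xs i \<in> A"
    and "B \<subseteq> Y" and "tonic ys j \<in> B"
  defines "A\<^sub>0 \<equiv> mode xs i ` A" and "B\<^sub>0 \<equiv> mode ys j ` B"
  shows "A\<^sub>0 \<in> C_obj n \<and> B\<^sub>0 \<in> C_obj n
    \<and> (orbit_cover_morphisms xs ys (orbit_cover xs A) (orbit_cover ys B) \<noteq> {} \<longleftrightarrow>
        (\<exists>u \<in> Zunits n. \<exists>b \<in> Zmod n. affine_map n u b ` A\<^sub>0 \<subseteq> B\<^sub>0))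
    \<and> (mode_morphisms xs i ys j (orbit_cover xs A) (orbit_cover ys B) \<noteq> {} \<longleftrightarrow>
        (\<exists>u \<in> Zunits n. \<exists>b \<in> Zmod n. affine_map n u b ` A\<^sub>0 \<subseteq> B\<^sub>0))
    \<and> (\<forall>u \<in> Zunits n. \<forall>b \<in> Zmod n.
        affine_map n u b ` A\<^sub>0 \<subseteq> B\<^sub>0 \<longleftrightarrow> dilation n u ` A\<^sub>0 \<subseteq> translation n (- b) ` B\<^sub>0)
    \<and> (orbit_cover_morphisms xs ys (orbit_cover xs A) (orbit_cover ys B) \<noteq> {} \<longleftrightarrow>
        C_hom n A\<^sub>0 B\<^sub>0 \<noteq> {})"
proof -
  note xs = normal_order_list[OF assms(1)] and ys = normal_order_list[OF assms(2)]
  have A: "A \<subseteq> set xs" and B: "B \<subseteq> set ys"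
    using assms xs(1) ys(1) by auto
  have ne: "xs \<noteq> []" "ys \<noteq> []"
    using xs(3,4) ys(3) by auto
  have A0: "A\<^sub>0 \<in> C_obj n"
    using mode_in_Zmod[OF ne(1)] mode_tonic(2)[OF xs(2) ne(1), of i] assms(6) xs(3)
    unfolding A\<^sub>0_def C_obj_def by force
  have B0: "B\<^sub>0 \<in> C_obj n"
    using mode_in_Zmod[OF ne(2)] mode_tonic(2)[OF ys(2) ne(2), of j] assms(8) ys(3)
    unfolding B\<^sub>0_def C_obj_def by force
  let ?P = "\<exists>u \<in> Zunits n. \<exists>b \<in> Zmod n. affine_map n u b ` A\<^sub>0 \<subseteq> B\<^sub>0"
  have mode: "mode_morphisms xs i' ys j' (orbit_cover xs A) (orbit_cover ys B) \<noteq> {} \<longleftrightarrow> ?P" for i' j'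
    unfolding A\<^sub>0_def B\<^sub>0_def
    by (rule mode_morphisms_nonempty_iff[OF xs(2) ys(2) xs(3) ys(3) xs(4) A B])
  have all: "orbit_cover_morphisms xs ys (orbit_cover xs A) (orbit_cover ys B) \<noteq> {} \<longleftrightarrow> ?P"
  proof -
    have "orbit_cover_morphisms xs ys (orbit_cover xs A) (orbit_cover ys B) \<noteq> {} \<longleftrightarrow>
        (\<exists>i' \<in> Zmod n. \<exists>j' \<in> Zmod n.
          mode_morphisms xs i' ys j' (orbit_cover xs A) (orbit_cover ys B) \<noteq> {})"
      unfolding orbit_cover_morphisms_def xs(3) ys(3) by blast
    also have "\<dots> \<longleftrightarrow> ?P"
      unfolding mode using assms(3,4) by blast
    finally show ?thesis .
  qed
  have hom: "C_hom n A\<^sub>0 B\<^sub>0 \<noteq> {} \<longleftrightarrow> ?P"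
    unfolding C_hom_def by blast
  have "affine_map n u b ` A\<^sub>0 \<subseteq> B\<^sub>0 \<longleftrightarrow> dilation n u ` A\<^sub>0 \<subseteq> translation n (- b) ` B\<^sub>0" for u b
    using affine_map_image_subset_iff_dilation A0 B0 xs(4) by (simp add: C_obj_def)
  then show ?thesis
    using A0 B0 mode all hom by simp
qed

end
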